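(* Let $m,n$ be positive integers, let $\mathcal{A}^I=[\underline{\mathcal{A}},\overline{\mathcal{A}}]$ be an interval $Z$-tensor in $T_{m,n}$, and let $\pi\in\mathbb{R}^n$ be a positive vector satisfying $0<\sum_{J\in[n]^{m-1}}\pi_J\le1$. Then $\mathcal{A}^I$ is an interval $B_\pi^{R^I}$-tensor if and only if $\underline{\mathcal{A}}$ is strictly diagonally dominant.
   Context: $[n]=\{1,\dots,n\}$. $T_{m,n}$ is the set of real $m$th-order $n$-dimensional tensors. For $J=(i_2,\dots,i_m)\in[n]^{m-1}$ write $a_{iJ}=a_{ii_2\cdots i_m}$. The $i$th row sum is $R_i(\mathcal{A})=\sum_{J\in[n]^{m-1}}a_{iJ}$. For a nonnegative vector $\pi=(\pi_1,\dots,\pi_n)$, $\pi_J:=\pi_{i_2}\cdots\pi_{i_m}$. A tensor $\mathcal{A}\in T_{m,n}$ is a $B_\pi^R$-tensor (where $\pi$ is a nonnegative vector with $0<\sum_{J\in[n]^{m-1}}\pi_J\le1$ and the superscript $R$ denotes the row sum vector of $\mathcal{A}$ itself) if for all $i\in[n]$: $R_i(\mathcal{A})>0$, and $\pi_JR_i(\mathcal{A})>a_{iJ}$ for all $J\in[n]^{m-1}\setminus\{(i,\dots,i)\}$. For $\underline{\mathcal{A}}\le\overline{\mathcal{A}}$ (componentwise) in $T_{m,n}$, the interval tensor is $\mathcal{A}^I=[\underline{\mathcal{A}},\overline{\mathcal{A}}]=\{\mathcal{A}:\underline{\mathcal{A}}\le\mathcal{A}\le\overline{\mathcal{A}}\}$.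 It is an interval $B_\pi^{R^I}$-tensor if every $\mathcal{A}\in\mathcal{A}^I$ is a $B_\pi^R$-tensor (same $\pi$, with $R=R(\mathcal{A})$). $\mathcal{A}$ is a $Z$-tensor if $a_{iJ}\le0$ for all $i\in[n]$ and $J\in[n]^{m-1}\setminus\{(i,\dots,i)\}$; $\mathcal{A}^I$ is an interval $Z$-tensor if every $\mathcal{A}\in\mathcal{A}^I$ is a $Z$-tensor. $\mathcal{A}$ is strictly diagonally dominant if $a_{ii\cdots i}>\sum_{J\in[n]^{m-1}\setminus\{(i,\dots,i)\}}|a_{iJ}|$ for all $i\in[n]$. *)

theory Defs
  imports Complex_Main "HOL-Library.FuncSet"
begin

definition multi_indices :: "nat \<Rightarrow> nat \<Rightarrow> nat list set" where
  "multi_indices n k = {J. length J = k \<and> set J \<subseteq> {1..n}}"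

text \<open>A tensor of order \<open>m\<close> and dimension \<open>n\<close> is a real function on \<open>[n]\<^sup>m\<close>, extended by
  \<open>undefined\<close> outside. The entry \<open>a\<^bsub>iJ\<^esub>\<close> with \<open>J \<in> [n]\<^bsup>m-1\<^esup>\<close> is \<open>A (i # J)\<close>.\<close>

type_synonym tensor = "nat list \<Rightarrow> real"

definition tensors :: "nat \<Rightarrow> nat \<Rightarrow> tensor set" where
  "tensors m n = (multi_indices n m \<rightarrow>\<^sub>E UNIV)"

text \<open>In the order-one case the tuple \<open>(i,\<dots>,i)\<close> of length \<open>m - 1\<close> is the empty tuple, so there
  are no off-diagonal indices.\<close>

definition off_diagonal :: "nat \<Rightarrow> nat \<Rightarrow> nat \<Rightarrow> nat list set" where
  "off_diagonal m n i = multi_indices n (m - 1) - {replicate (m - 1) i}"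

definition row_sum :: "nat \<Rightarrow> nat \<Rightarrow> tensor \<Rightarrow> nat \<Rightarrow> real" where
  "row_sum m n A i = (\<Sum>J\<in>multi_indices n (m - 1). A (i # J))"

definition vec_prod :: "(nat \<Rightarrow> real) \<Rightarrow> nat list \<Rightarrow> real" where
  "vec_prod \<pi> J = prod_list (map \<pi> J)"

text \<open>Vectors in \<open>\<real>\<^sup>n\<close> are functions of which only the values on \<open>{1..n}\<close> are used.\<close>

definition B_pi_R_tensor :: "nat \<Rightarrow> nat \<Rightarrow> (nat \<Rightarrow> real) \<Rightarrow> tensor \<Rightarrow> bool" where
  "B_pi_R_tensor m n \<pi> A \<longleftrightarrow>
     A \<in> tensors m n \<and>
     (\<forall>i\<in>{1..n}. 0 \<le> \<pi> i) \<and>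
     0 < (\<Sum>J\<in>multi_indices n (m - 1). vec_prod \<pi> J) \<and>
     (\<Sum>J\<in>multi_indices n (m - 1). vec_prod \<pi> J) \<le> 1 \<and>
     (\<forall>i\<in>{1..n}. row_sum m n A i > 0 \<and>
        (\<forall>J\<in>off_diagonal m n i. vec_prod \<pi> J * row_sum m n A i > A (i # J)))"

definition Z_tensor :: "nat \<Rightarrow> nat \<Rightarrow> tensor \<Rightarrow> bool" where
  "Z_tensor m n A \<longleftrightarrow>
     A \<in> tensors m n \<and> (\<forall>i\<in>{1..n}. \<forall>J\<in>off_diagonal m n i. A (i # J) \<le> 0)"

definition strictly_diagonally_dominant :: "nat \<Rightarrow> nat \<Rightarrow> tensor \<Rightarrow> bool" where
  "strictly_diagonally_dominant m n A \<longleftrightarrow>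
     A \<in> tensors m n \<and>
     (\<forall>i\<in>{1..n}. A (replicate m i) > (\<Sum>J\<in>off_diagonal m n i. \<bar>A (i # J)\<bar>))"

definition tensor_le :: "nat \<Rightarrow> nat \<Rightarrow> tensor \<Rightarrow> tensor \<Rightarrow> bool" where
  "tensor_le m n A B \<longleftrightarrow> (\<forall>K\<in>multi_indices n m. A K \<le> B K)"

definition interval_tensor :: "nat \<Rightarrow> nat \<Rightarrow> tensor \<Rightarrow> tensor \<Rightarrow> tensor set" where
  "interval_tensor m n L U = {A \<in> tensors m n. tensor_le m n L A \<and> tensor_le m n A U}"

definition interval_B_pi_R_tensor :: "nat \<Rightarrow> nat \<Rightarrow> (nat \<Rightarrow> real) \<Rightarrow> tensor set \<Rightarrow> bool" where
  "interval_B_pi_R_tensor m n \<pi> AI \<longleftrightarrow> (\<forall>A\<in>AI. B_pi_R_tensor m n \<pi> A)"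

definition interval_Z_tensor :: "nat \<Rightarrow> nat \<Rightarrow> tensor set \<Rightarrow> bool" where
  "interval_Z_tensor m n AI \<longleftrightarrow> (\<forall>A\<in>AI. Z_tensor m n A)"

end

theory Submission
  imports Defs
begin

text \<open>
  For a Z-tensor every off-diagonal entry satisfies \<open>a\<^bsub>iJ\<^esub> = - \<bar>a\<^bsub>iJ\<^esub>\<bar>\<close>, so the \<open>i\<close>th row sum
  equals the diagonal entry minus the sum of the absolute values of the off-diagonal entries
  (\<open>Z_tensor_row_sum\<close>). Strict diagonal dominance therefore says exactly that all row sums are
  positive. Let \<open>\<pi>\<close> be positive with \<open>0 < (\<Sum>J. \<pi>\<^sub>J) \<le> 1\<close>. Once the row sums are positive, the
  inequalities \<open>\<pi>\<^sub>J R\<^sub>i > a\<^bsub>iJ\<^esub>\<close> hold automatically, with a positive left-hand side and a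
  nonpositive right-hand side, so the \<open>B\<^sub>\<pi>\<^sup>R\<close> property of a single
  Z-tensor is positivity of its row sums as well (\<open>Z_tensor_B_pi_R_iff\<close>). Row sums are monotone in
  the tensor, so among all members of the interval only the lower endpoint has to be tested.
\<close>

lemma finite_multi_indices: "finite (multi_indices n k)"
  using finite_lists_length_eq[of "{1..n}" k]
  by (simp add: multi_indices_def conj_commute)

lemma Cons_in_multi_indices:
  assumes "m \<ge> 1" and "i \<in> {1..n}" and "J \<in> multi_indices n (m - 1)"
  shows "i # J \<in> multi_indices n m"
  using assms by (auto simp: multi_indices_def)

lemma row_sum_split:
  assumes "m \<ge> 1" and "i \<in> {1..n}"
  shows "row_sum m n A i = A (replicate m i) + (\<Sum>J\<in>off_diagonal m n i. A (i # J))"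
proof -
  have "replicate (m - 1) i \<in> multi_indices n (m - 1)"
    using assms by (auto simp: multi_indices_def)
  moreover have "i # replicate (m - 1) i = replicate m i"
    using assms by (cases m) auto
  ultimately show ?thesis
    by (simp add: row_sum_def off_diagonal_def sum.remove finite_multi_indices)
qed

lemma row_sum_mono:
  assumes "m \<ge> 1" and "i \<in> {1..n}" and "tensor_le m n A B"
  shows "row_sum m n A i \<le> row_sum m n B i"
  using assms Cons_in_multi_indices[of m i n]
  unfolding row_sum_def tensor_le_def by (intro sum_mono) blast

lemma vec_prod_pos:
  assumes "\<forall>i\<in>{1..n}. 0 < \<pi> i" and "set J \<subseteq> {1..n}"
  shows "0 < vec_prod \<pi> J"
  using assms(2)
proof (induction J)
  case Nil
  show ?case by (simp add: vec_prod_def)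
next
  case (Cons j J)
  then have "0 < \<pi> j" and "0 < vec_prod \<pi> J"
    using assms(1) by auto
  then show ?case by (simp add: vec_prod_def)
qed

lemma Z_tensor_row_sum:
  assumes "m \<ge> 1" and "i \<in> {1..n}" and "Z_tensor m n A"
  shows "row_sum m n A i = A (replicate m i) - (\<Sum>J\<in>off_diagonal m n i. \<bar>A (i # J)\<bar>)"
proof -
  have "\<bar>A (i # J)\<bar> = - A (i # J)" if "J \<in> off_diagonal m n i" for J
    using assms that by (auto simp: Z_tensor_def)
  then have "(\<Sum>J\<in>off_diagonal m n i. \<bar>A (i # J)\<bar>) = - (\<Sum>J\<in>off_diagonal m n i. A (i # J))"
    by (simp add: sum_negf)
  then show ?thesis
    using row_sum_split[OF assms(1,2)] by simp
qed

lemma Z_tensor_strictly_diagonally_dominant_iff: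
  assumes "m \<ge> 1" and "Z_tensor m n A"
  shows "strictly_diagonally_dominant m n A \<longleftrightarrow> (\<forall>i\<in>{1..n}. 0 < row_sum m n A i)"
  using assms Z_tensor_row_sum[OF assms(1) _ assms(2)]
  by (auto simp: strictly_diagonally_dominant_def Z_tensor_def)

lemma Z_tensor_B_pi_R_iff:
  assumes "Z_tensor m n A"
    and pos: "\<forall>i\<in>{1..n}. 0 < \<pi> i"
    and "0 < (\<Sum>J\<in>multi_indices n (m - 1). vec_prod \<pi> J)"
    and "(\<Sum>J\<in>multi_indices n (m - 1). vec_prod \<pi> J) \<le> 1"
  shows "B_pi_R_tensor m n \<pi> A \<longleftrightarrow> (\<forall>i\<in>{1..n}. 0 < row_sum m n A i)"
proof
  assume "B_pi_R_tensor m n \<pi> A"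
  then show "\<forall>i\<in>{1..n}. 0 < row_sum m n A i"
    by (simp add: B_pi_R_tensor_def)
next
  assume rows: "\<forall>i\<in>{1..n}. 0 < row_sum m n A i"
  have "A (i # J) < vec_prod \<pi> J * row_sum m n A i"
    if "i \<in> {1..n}" and "J \<in> off_diagonal m n i" for i J
  proof -
    have "A (i # J) \<le> 0"
      using assms(1) that by (simp add: Z_tensor_def)
    also have "0 < vec_prod \<pi> J"
      using that by (intro vec_prod_pos[OF pos]) (auto simp: off_diagonal_def multi_indices_def)
    then have "0 < vec_prod \<pi> J * row_sum m n A i"
      using rows that by simp
    finally show ?thesis .
  qed
  then show "B_pi_R_tensor m n \<pi> A"
    using assms rows by (auto simp: B_pi_R_tensor_def Z_tensor_def less_imp_le)
qed

theorem proposition4p3: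
  fixes m n :: nat and L U :: tensor and \<pi> :: "nat \<Rightarrow> real"
  assumes "m \<ge> 1" and "n \<ge> 1"
    and "L \<in> tensors m n" and "U \<in> tensors m n" and "tensor_le m n L U"
    and "interval_Z_tensor m n (interval_tensor m n L U)"
    and "\<forall>i\<in>{1..n}. 0 < \<pi> i"
    and "0 < (\<Sum>J\<in>multi_indices n (m - 1). vec_prod \<pi> J)"
    and "(\<Sum>J\<in>multi_indices n (m - 1). vec_prod \<pi> J) \<le> 1"
  shows "interval_B_pi_R_tensor m n \<pi> (interval_tensor m n L U) \<longleftrightarrow>
         strictly_diagonally_dominant m n L"
proof -
  let ?I = "interval_tensor m n L U"
  have L_in: "L \<in> ?I"
    using assms(3,5) by (simp add: interval_tensor_def tensor_le_def)
  have Z: "Z_tensor m n A" if "A \<in> ?I" for A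
    using assms(6) that by (simp add: interval_Z_tensor_def)
  have "interval_B_pi_R_tensor m n \<pi> ?I \<longleftrightarrow> (\<forall>A\<in>?I. \<forall>i\<in>{1..n}. 0 < row_sum m n A i)"
    using Z_tensor_B_pi_R_iff[OF Z assms(7-9)] by (simp add: interval_B_pi_R_tensor_def)
  also have "\<dots> \<longleftrightarrow> (\<forall>i\<in>{1..n}. 0 < row_sum m n L i)"
  proof
    assume "\<forall>A\<in>?I. \<forall>i\<in>{1..n}. 0 < row_sum m n A i"
    then show "\<forall>i\<in>{1..n}. 0 < row_sum m n L i"
      using L_in by blast
  next
    assume rows: "\<forall>i\<in>{1..n}. 0 < row_sum m n L i"
    show "\<forall>A\<in>?I. \<forall>i\<in>{1..n}. 0 < row_sum m n A i"
    proof (intro ballI)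
      fix A i assume "A \<in> ?I" and i: "i \<in> {1..n}"
      then have "row_sum m n L i \<le> row_sum m n A i"
        using assms(1) by (intro row_sum_mono) (simp_all add: interval_tensor_def)
      then show "0 < row_sum m n A i"
        using rows i by fastforce
    qed
  qed
  also have "\<dots> \<longleftrightarrow> strictly_diagonally_dominant m n L"
    using Z_tensor_strictly_diagonally_dominant_iff[OF assms(1) Z[OF L_in]] by simp
  finally show ?thesis .
qed

end
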